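(* Let $\Omega$ be a nonempty subset of $\mathbb{R}^n$, let $F\in\mathcal{F}^1(\Omega)$ and assume $\kappa:=\Gamma^1(F;\Omega)>0$. Let $U^-$ be the 1-field on $\mathbb{R}^n$ given by $U^-(x)(a)=u^-(x)+\langle D_xu^-,a-x\rangle$ ($x,a\in\mathbb{R}^n$), where $$u^-(x)=\min_{v\in\Lambda_x}\sup_{a\in\Omega}\Psi^-(F,x,a,v),\qquad D_xu^-=\arg\min_{v\in\Lambda_x}\sup_{a\in\Omega}\Psi^-(F,x,a,v).$$ Then $U^-$ is the unique under extremal Lipschitz extension of $F$ on $\mathbb{R}^n$.
   Context: Fix an integer $n\ge 1$; $\mathbb{R}^n$ carries the standard scalar product and Euclidean norm. A 1-field on a nonempty set $\Omega\subset\mathbb{R}^n$ is a map $F$ assigning to each $x\in \Omega$ the polynomial $F(x)(a)=f_x+\langle D_xf,a-x\rangle$ ($a\in\mathbb{R}^n$), where $f_x\in\mathbb{R}$ and $D_xf\in\mathbb{R}^n$ (a 1-field $G$ similarly has associated data $g(x)=g_x$ and $D_xg$). For $x\ne y$ in $\Omega$, $$\Gamma^1(F;x,y)=2\sup_{a\in\mathbb{R}^n}\frac{|F(x)(a)-F(y)(a)|}{\|x-a\|^2+\|y-a\|^2},$$ and $\Gamma^1(F;\Omega)=\sup_{x\ne y\in \Omega}\Gamma^1(F;x,y)$. $\mathcal{F}^1(\Omega)$ is the set of 1-fields on $\Omega$ with $\Gamma^1(F;\Omega)<+\infty$. For $\Omega_1\subset\Omega_2$ and $F\in\mathcal{F}^1(\Omega_1)$: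 $G\in\mathcal{F}^1(\Omega_2)$ is an extension of $F$ if $G(x)=F(x)$ for $x\in\Omega_1$; it is a minimal Lipschitz extension (MLE) of $F$ on $\Omega_2$ if moreover $\Gamma^1(G;\Omega_2)=\Gamma^1(F;\Omega_1)$. An MLE $G_2$ of $F$ on $\Omega_2$ is an under extremal Lipschitz extension of $F$ on $\Omega_2$ if $g_2(x)\le k(x)$ for all $x\in\Omega_2$ and every MLE $K$ of $F$ on $\Omega_2$. For $a,b\in\Omega$ and $x\in\mathbb{R}^n$ set $$v_{a,b}=\tfrac12(D_af+D_bf)+\tfrac{\kappa}{2}(b-a),$$ $$\alpha_{a,b}=2\kappa(f_a-f_b)+\kappa\langle D_af+D_bf,b-a\rangle-\tfrac12\|D_af-D_bf\|^2+\tfrac{\kappa^2}{2}\|a-b\|^2,$$ $$\beta_{a,b}(x)=\left\|\tfrac12(D_af-D_bf)+\tfrac{\kappa}{2}(2x-a-b)\right\|^2,\qquad r_{a,b}(x)=\sqrt{\alpha_{a,b}+\beta_{a,b}(x)},$$ (it is known that $\alpha_{a,b}\ge0$), and $$\Lambda_x=\{v\in\mathbb{R}^n:\ \|v-v_{a,b}\|\le r_{a,b}(x)\ \text{for all } a,b\in\Omega\},$$ which is known to be nonempty. For $a\in\Omega$ and $x,v\in\mathbb{R}^n$, $$\Psi^-(F,x,a,v)=f_a+\tfrac12\langle D_af+v,x-a\rangle-\tfrac{\kappa}{4}\|a-x\|^2+\tfrac{1}{4\kappa}\|D_af-v\|^2.$$ The minimum over $\Lambda_x$ is attained at a unique point,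 so $D_xu^-$ is well defined. *)

theory Defs
  imports "HOL-Analysis.Analysis"
begin

text \<open>A 1-field is given by its data \<open>x \<mapsto> (f\<^sub>x, D\<^sub>x f)\<close>. It is a total function;
  for a field on \<open>\<Omega>\<close> the values outside \<open>\<Omega>\<close> are irrelevant: no definition below
  depends on them.\<close>

type_synonym 'a field1 = "'a \<Rightarrow> real \<times> 'a"

abbreviation val :: "'a field1 \<Rightarrow> 'a \<Rightarrow> real"
  where "val F x \<equiv> fst (F x)"

abbreviation grad :: "'a field1 \<Rightarrow> 'a \<Rightarrow> 'a"
  where "grad F x \<equiv> snd (F x)"

definition poly1 :: "('a::euclidean_space) field1 \<Rightarrow> 'a \<Rightarrow> 'a \<Rightarrow> real"
  where "poly1 F x a = val F x + grad F x \<bullet> (a - x)"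

text \<open>Suprema of nonnegative quantities are taken in \<^typ>\<open>ennreal\<close>, so that
  the supremum over an empty set of pairs (\<open>\<Omega>\<close> a singleton) is 0.\<close>

definition Gamma1_pair :: "('a::euclidean_space) field1 \<Rightarrow> 'a \<Rightarrow> 'a \<Rightarrow> ennreal"
  where "Gamma1_pair F x y =
    2 * (SUP a. ennreal (\<bar>poly1 F x a - poly1 F y a\<bar> / ((norm (x - a))\<^sup>2 + (norm (y - a))\<^sup>2)))"

definition Gamma1 :: "('a::euclidean_space) field1 \<Rightarrow> 'a set \<Rightarrow> ennreal"
  where "Gamma1 F \<Omega> = (SUP (x, y) \<in> {(x, y). x \<in> \<Omega> \<and> y \<in> \<Omega> \<and> x \<noteq> y}. Gamma1_pair F x y)"

definition fields1 :: "('a::euclidean_space) set \<Rightarrow> 'a field1 set"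
  where "fields1 \<Omega> = {F. Gamma1 F \<Omega> < \<infinity>}"

definition is_extension :: "('a::euclidean_space) field1 \<Rightarrow> 'a set \<Rightarrow> 'a set \<Rightarrow> 'a field1 \<Rightarrow> bool"
  where "is_extension F \<Omega>\<^sub>1 \<Omega>\<^sub>2 G \<longleftrightarrow>
    G \<in> fields1 \<Omega>\<^sub>2 \<and> (\<forall>x\<in>\<Omega>\<^sub>1. poly1 G x = poly1 F x)"

definition is_MLE :: "('a::euclidean_space) field1 \<Rightarrow> 'a set \<Rightarrow> 'a set \<Rightarrow> 'a field1 \<Rightarrow> bool"
  where "is_MLE F \<Omega>\<^sub>1 \<Omega>\<^sub>2 G \<longleftrightarrow>
    is_extension F \<Omega>\<^sub>1 \<Omega>\<^sub>2 G \<and> Gamma1 G \<Omega>\<^sub>2 = Gamma1 F \<Omega>\<^sub>1"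

definition is_under_extremal ::
  "('a::euclidean_space) field1 \<Rightarrow> 'a set \<Rightarrow> 'a set \<Rightarrow> 'a field1 \<Rightarrow> bool"
  where "is_under_extremal F \<Omega>\<^sub>1 \<Omega>\<^sub>2 G \<longleftrightarrow>
    is_MLE F \<Omega>\<^sub>1 \<Omega>\<^sub>2 G \<and>
    (\<forall>K. is_MLE F \<Omega>\<^sub>1 \<Omega>\<^sub>2 K \<longrightarrow> (\<forall>x\<in>\<Omega>\<^sub>2. val G x \<le> val K x))"

definition center :: "real \<Rightarrow> ('a::euclidean_space) field1 \<Rightarrow> 'a \<Rightarrow> 'a \<Rightarrow> 'a"
  where "center \<kappa> F a b = (1/2) *\<^sub>R (grad F a + grad F b) + (\<kappa>/2) *\<^sub>R (b - a)"

definition alpha :: "real \<Rightarrow> ('a::euclidean_space) field1 \<Rightarrow> 'a \<Rightarrow> 'a \<Rightarrow> real"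
  where "alpha \<kappa> F a b =
    2 * \<kappa> * (val F a - val F b) + \<kappa> * ((grad F a + grad F b) \<bullet> (b - a))
    - 1/2 * (norm (grad F a - grad F b))\<^sup>2 + \<kappa>\<^sup>2 / 2 * (norm (a - b))\<^sup>2"

definition beta :: "real \<Rightarrow> ('a::euclidean_space) field1 \<Rightarrow> 'a \<Rightarrow> 'a \<Rightarrow> 'a \<Rightarrow> real"
  where "beta \<kappa> F a b x =
    (norm ((1/2) *\<^sub>R (grad F a - grad F b) + (\<kappa>/2) *\<^sub>R (2 *\<^sub>R x - a - b)))\<^sup>2"

definition radius :: "real \<Rightarrow> ('a::euclidean_space) field1 \<Rightarrow> 'a \<Rightarrow> 'a \<Rightarrow> 'a \<Rightarrow> real"
  where "radius \<kappa> F a b x = sqrt (alpha \<kappa> F a b + beta \<kappa> F a b x)"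

definition Lambda_set ::
  "real \<Rightarrow> ('a::euclidean_space) field1 \<Rightarrow> 'a set \<Rightarrow> 'a \<Rightarrow> 'a set"
  where "Lambda_set \<kappa> F \<Omega> x = {v. \<forall>a\<in>\<Omega>. \<forall>b\<in>\<Omega>. norm (v - center \<kappa> F a b) \<le> radius \<kappa> F a b x}"

definition Psi_minus :: "real \<Rightarrow> ('a::euclidean_space) field1 \<Rightarrow> 'a \<Rightarrow> 'a \<Rightarrow> 'a \<Rightarrow> real"
  where "Psi_minus \<kappa> F x a v =
    val F a + 1/2 * ((grad F a + v) \<bullet> (x - a)) - \<kappa>/4 * (norm (a - x))\<^sup>2
    + 1 / (4 * \<kappa>) * (norm (grad F a - v))\<^sup>2"

text \<open>The supremum over \<open>a \<in> \<Omega>\<close> is taken in \<^typ>\<open>ereal\<close>, since for a general \<open>v\<close>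
  and unbounded \<open>\<Omega>\<close> it may be infinite.\<close>

definition sup_Psi_minus ::
  "real \<Rightarrow> ('a::euclidean_space) field1 \<Rightarrow> 'a set \<Rightarrow> 'a \<Rightarrow> 'a \<Rightarrow> ereal"
  where "sup_Psi_minus \<kappa> F \<Omega> x v = (SUP a\<in>\<Omega>. ereal (Psi_minus \<kappa> F x a v))"

definition U_minus :: "('a::euclidean_space) field1 \<Rightarrow> 'a set \<Rightarrow> 'a field1"
  where "U_minus F \<Omega> x =
    (let \<kappa> = enn2real (Gamma1 F \<Omega>) in
      (real_of_ereal (INF v\<in>Lambda_set \<kappa> F \<Omega> x. sup_Psi_minus \<kappa> F \<Omega> x v),
       arg_min_on (sup_Psi_minus \<kappa> F \<Omega> x) (Lambda_set \<kappa> F \<Omega> x)))"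

end

theory Submission
  imports Defs
begin

text \<open>
  Write \<open>\<kappa>\<close> for the constant of \<open>F\<close> on \<open>\<Omega>\<close>, and call a pair \<open>(s, v)\<close> of a value and a gradient
  a jet. Everything rests on reading the pairwise seminorm one side at a time: minimising a
  quadratic polynomial shows that for \<open>x \<noteq> y\<close>, \<open>Gamma1_pair F x y \<le> \<kappa>\<close> says exactly that
  \<open>Psi_minus \<kappa> F y x (grad F y) \<le> val F y\<close>, together with the same inequality for \<open>x\<close> and \<open>y\<close>
  exchanged (lemma \<open>Gamma1_pair_le_iff\<close>). So \<open>Psi_minus \<kappa> F x a v\<close> is the lower bound that
  the jet of \<open>F\<close> at \<open>a\<close> puts on the value of a jet at \<open>x\<close> with gradient \<open>v\<close>. Call \<open>(s, v)\<close> admissible at \<open>x\<close> if \<open>s\<close>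
  dominates \<open>Psi_minus \<kappa> F x a v\<close> for all \<open>a \<in> \<Omega>\<close>. The jets of every MLE of \<open>F\<close> are
  admissible, so the least admissible values bound all MLEs from below. What remains is
  that these least values themselves come from an MLE.

  Up to the common term \<open>1/(4*\<kappa>) * (norm v)\<^sup>2\<close>, each \<open>Psi_minus \<kappa> F x a\<close> is affine, so
  their supremum is strongly convex. Hence there is a unique admissible jet \<open>(u, d)\<close> of
  least value at \<open>x\<close>, and every admissible \<open>(s, v)\<close> satisfies
  \<open>u + 1/(4*\<kappa>) * (norm (v - d))\<^sup>2 \<le> s\<close> (lemma \<open>least_jet_exists\<close>).

  Admissible jets can be moved (lemma \<open>admissible_transport\<close>): if \<open>(s, v)\<close> is admissible at \<open>y\<close>, then
  the parabola \<open>x \<mapsto> s + v \<bullet> (x - y) + \<kappa>/2 * (norm (x - y))\<^sup>2\<close> and its gradient are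
  admissible at every \<open>x\<close>. Applied to the least jet at \<open>y\<close> and combined with the quadratic
  growth at \<open>x\<close>, this is the pairwise condition for the field of least jets (lemma
  \<open>Psi_minus_le_least_jets\<close>). On \<open>\<Omega>\<close> the least jets are those of \<open>F\<close>, so the field of least jets is
  an MLE. The gradients of an MLE lie in the sets \<open>\<Lambda>\<^sub>x\<close>, so the restriction to \<open>\<Lambda>\<^sub>x\<close> does not
  change the minimisation, and the field of least jets is \<open>U_minus F \<Omega>\<close>. If \<open>G\<close> is another under
  extremal extension, it has the same values and admissible jets, and the quadratic growth
  forces the gradients to agree.

  In convex terms, after adding \<open>\<kappa>/2 * (norm x)\<^sup>2\<close>, the least field is the Moreau envelope of a
  supremum of affine functions.
\<close>

section \<open>The seminorm as a pairwise lower bound\<close>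

text \<open>Two expansions that keep \<open>1/(4*\<kappa>)\<close> as a common factor: after them the identities below
  are linear in \<open>1/\<kappa>\<close>.\<close>

lemma scaled_square_minus:
  fixes w e :: "'a::real_inner"
  assumes "\<kappa> > 0"
  shows "\<kappa> * (norm (w - (1/(2*\<kappa>)) *\<^sub>R e))\<^sup>2 = \<kappa> * (norm w)\<^sup>2 - w \<bullet> e + 1/(4*\<kappa>) * (norm e)\<^sup>2"
  using assms unfolding power2_norm_eq_inner
  by (simp add: inner_simps inner_commute field_simps power2_eq_square)

lemma inverse_scaled_square_minus:
  fixes w e :: "'a::real_inner"
  assumes "\<kappa> > 0"
  shows "1/(4*\<kappa>) * (norm (w - \<kappa> *\<^sub>R e))\<^sup>2
    = 1/(4*\<kappa>) * (norm w)\<^sup>2 - 1/2 * (w \<bullet> e) + \<kappa>/4 * (norm e)\<^sup>2"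
  using assms unfolding power2_norm_eq_inner
  by (simp add: inner_simps inner_commute field_simps power2_eq_square)

text \<open>The source of \<^const>\<open>Psi_minus\<close>: as a function of \<open>a\<close>, the slack in the one-sided
  inequality between the two polynomials is a quadratic whose minimum is
  \<open>val F y - Psi_minus \<kappa> F y x (grad F y)\<close>.\<close>

lemma Psi_minus_complete_square:
  assumes "\<kappa> > 0"
  shows "\<kappa>/2 * ((norm (x - a))\<^sup>2 + (norm (y - a))\<^sup>2) - (poly1 F x a - poly1 F y a) =
    \<kappa> * (norm (a - (1/2) *\<^sub>R (x + y) - (1/(2*\<kappa>)) *\<^sub>R (grad F x - grad F y)))\<^sup>2
      + (val F y - Psi_minus \<kappa> F y x (grad F y))"
  unfolding scaled_square_minus[OF assms] poly1_def Psi_minus_def power2_norm_eq_inner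
  using assms by (simp add: inner_simps inner_commute algebra_simps)

lemma poly1_diff_le_iff:
  assumes "\<kappa> > 0"
  shows "(\<forall>a. poly1 F x a - poly1 F y a \<le> \<kappa>/2 * ((norm (x - a))\<^sup>2 + (norm (y - a))\<^sup>2)) \<longleftrightarrow>
    Psi_minus \<kappa> F y x (grad F y) \<le> val F y" (is "?L \<longleftrightarrow> ?R")
proof
  assume L: ?L
  define a where "a = (1/2) *\<^sub>R (x + y) + (1/(2*\<kappa>)) *\<^sub>R (grad F x - grad F y)"
  show ?R
    using L[rule_format, of a] Psi_minus_complete_square[OF assms, of x a y F]
    by (simp add: a_def)
next
  assume R: ?R
  show ?L
  proof
    fix a
    have "0 \<le> \<kappa> * (norm (a - (1/2) *\<^sub>R (x + y) - (1/(2*\<kappa>)) *\<^sub>R (grad F x - grad F y)))\<^sup>2"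
      using assms by simp
    with R Psi_minus_complete_square[OF assms, of x a y F]
    show "poly1 F x a - poly1 F y a \<le> \<kappa>/2 * ((norm (x - a))\<^sup>2 + (norm (y - a))\<^sup>2)"
      by linarith
  qed
qed

lemma Gamma1_pair_le_iff_poly1:
  assumes "\<kappa> > 0" "x \<noteq> y"
  shows "Gamma1_pair F x y \<le> ennreal \<kappa> \<longleftrightarrow>
    (\<forall>a. \<bar>poly1 F x a - poly1 F y a\<bar> \<le> \<kappa>/2 * ((norm (x - a))\<^sup>2 + (norm (y - a))\<^sup>2))"
proof -
  let ?N = "\<lambda>a. (norm (x - a))\<^sup>2 + (norm (y - a))\<^sup>2"
  have pos: "?N a > 0" for a
    using assms(2) by (cases "x = a") (auto intro: add_pos_nonneg)
  have two: "2 * s \<le> ennreal \<kappa> \<longleftrightarrow> s \<le> ennreal (\<kappa>/2)" for s :: ennreal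
  proof -
    have "ennreal \<kappa> = 2 * ennreal (\<kappa>/2)"
      by (metis ennreal_mult' ennreal_numeral mult_2 field_sum_of_halves zero_le_numeral)
    then show ?thesis
      by (simp add: ennreal_mult_le_mult_iff)
  qed
  have quot: "ennreal (\<bar>d\<bar> / ?N a) \<le> ennreal (\<kappa>/2) \<longleftrightarrow> \<bar>d\<bar> \<le> \<kappa>/2 * ?N a" for a d
    using assms(1) pos[of a] by (simp add: ennreal_le_iff pos_divide_le_eq)
  show ?thesis
    unfolding Gamma1_pair_def two SUP_le_iff quot by simp
qed

lemma Gamma1_pair_le_iff:
  assumes "\<kappa> > 0" "x \<noteq> y"
  shows "Gamma1_pair F x y \<le> ennreal \<kappa> \<longleftrightarrow>
    Psi_minus \<kappa> F y x (grad F y) \<le> val F y \<and> Psi_minus \<kappa> F x y (grad F x) \<le> val F x"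
  unfolding Gamma1_pair_le_iff_poly1[OF assms]
    poly1_diff_le_iff[OF assms(1), symmetric] abs_le_iff
  by (auto simp: add.commute)

lemma Psi_minus_self: "Psi_minus \<kappa> F a a v = val F a + 1/(4*\<kappa>) * (norm (grad F a - v))\<^sup>2"
  by (simp add: Psi_minus_def)

lemma Gamma1_le_iff:
  assumes "\<kappa> > 0"
  shows "Gamma1 F \<Omega> \<le> ennreal \<kappa> \<longleftrightarrow>
    (\<forall>x\<in>\<Omega>. \<forall>y\<in>\<Omega>. Psi_minus \<kappa> F y x (grad F y) \<le> val F y)"
proof -
  have "Gamma1 F \<Omega> \<le> ennreal \<kappa> \<longleftrightarrow>
      (\<forall>x\<in>\<Omega>. \<forall>y\<in>\<Omega>. x \<noteq> y \<longrightarrow> Gamma1_pair F x y \<le> ennreal \<kappa>)"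
    unfolding Gamma1_def SUP_le_iff by auto
  also have "\<dots> \<longleftrightarrow> (\<forall>x\<in>\<Omega>. \<forall>y\<in>\<Omega>. x \<noteq> y \<longrightarrow> Psi_minus \<kappa> F y x (grad F y) \<le> val F y)"
    using Gamma1_pair_le_iff[OF assms] by metis
  also have "\<dots> \<longleftrightarrow> (\<forall>x\<in>\<Omega>. \<forall>y\<in>\<Omega>. Psi_minus \<kappa> F y x (grad F y) \<le> val F y)"
    by (metis Psi_minus_self diff_self norm_zero zero_power2 mult_zero_right add_0_right order_refl)
  finally show ?thesis .
qed

section \<open>Least admissible jets\<close>

text \<open>A minimiser exists even if the supremum is infinite for some \<open>v\<close>: the part below height
  \<open>s0\<close> of the epigraph is closed, and it is bounded because already one index \<open>i0\<close> gives a
  paraboloid below it. The height attains its minimum on this compact set.\<close>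

lemma exists_min_sup_affine_plus_square:
  fixes q :: "'i \<Rightarrow> 'a::euclidean_space" and c :: "'i \<Rightarrow> real"
  assumes "\<mu> > 0" "I \<noteq> {}"
    and "\<forall>i\<in>I. c i + q i \<bullet> v0 + \<mu> * (norm v0)\<^sup>2 \<le> s0"
  obtains u d where "\<forall>i\<in>I. c i + q i \<bullet> d + \<mu> * (norm d)\<^sup>2 \<le> u"
    and "\<And>s v. \<forall>i\<in>I. c i + q i \<bullet> v + \<mu> * (norm v)\<^sup>2 \<le> s \<Longrightarrow> u \<le> s"
proof -
  obtain i0 where i0: "i0 \<in> I" using assms(2) by auto
  define K where "K = (\<Inter>i\<in>I. {p. c i + q i \<bullet> snd p + \<mu> * (norm (snd p))\<^sup>2 \<le> fst p}) \<inter> {p. fst p \<le> s0}"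
  have "closed K"
    unfolding K_def
    by (intro closed_Int closed_INT ballI closed_Collect_le continuous_intros)
  define w where "w = (1/(2*\<mu>)) *\<^sub>R q i0"
  define R where "R = (s0 - c i0 + \<mu> * (norm w)\<^sup>2) / \<mu>"
  have square: "c i0 + q i0 \<bullet> v + \<mu> * (norm v)\<^sup>2 = c i0 - \<mu> * (norm w)\<^sup>2 + \<mu> * (norm (v + w))\<^sup>2" for v
    using assms(1) unfolding w_def power2_norm_eq_inner
    by (simp add: inner_simps inner_commute field_simps power2_eq_square)
  have "K \<subseteq> {c i0 - \<mu> * (norm w)\<^sup>2 .. s0} \<times> cball (- w) (sqrt R)"
  proof
    fix p assume p: "p \<in> K"
    have le: "c i0 - \<mu> * (norm w)\<^sup>2 + \<mu> * (norm (snd p + w))\<^sup>2 \<le> fst p" "fst p \<le> s0"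
      using p i0 square[of "snd p"] unfolding K_def by auto
    have "0 \<le> \<mu> * (norm (snd p + w))\<^sup>2" using assms(1) by simp
    moreover have "(norm (snd p + w))\<^sup>2 \<le> R"
      using le assms(1) unfolding R_def by (simp add: field_simps)
    then have "norm (snd p + w) \<le> sqrt R" by (rule real_le_rsqrt)
    ultimately show "p \<in> {c i0 - \<mu> * (norm w)\<^sup>2 .. s0} \<times> cball (- w) (sqrt R)"
      using le by (cases p) (auto simp: dist_norm norm_minus_commute add.commute)
  qed
  then have "bounded K"
    by (rule bounded_subset[rotated]) (intro bounded_Times bounded_closed_interval bounded_cball)
  with \<open>closed K\<close> have "compact K" by (simp add: compact_eq_bounded_closed)
  moreover have "(s0, v0) \<in> K" using assms(3) by (simp add: K_def)
  ultimately obtain p where p: "p \<in> K" "\<And>p'. p' \<in> K \<Longrightarrow> fst p \<le> fst p'"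
    using continuous_attains_inf[of K fst] continuous_on_fst[OF continuous_on_id] by blast
  show thesis
  proof (rule that[of "snd p" "fst p"])
    show "\<forall>i\<in>I. c i + q i \<bullet> snd p + \<mu> * (norm (snd p))\<^sup>2 \<le> fst p"
      using p(1) by (simp add: K_def)
    fix s v assume sv: "\<forall>i\<in>I. c i + q i \<bullet> v + \<mu> * (norm v)\<^sup>2 \<le> s"
    show "fst p \<le> s"
    proof (cases "s \<le> s0")
      case True
      then have "(s, v) \<in> K" using sv by (simp add: K_def)
      then show ?thesis using p(2) by fastforce
    next
      case False
      then show ?thesis using p(1) by (simp add: K_def)
    qed
  qed
qed

lemma Psi_minus_eq_affine_plus_square:
  assumes "\<kappa> > 0"
  shows "Psi_minus \<kappa> F x a v =
    (val F a + 1/2 * (grad F a \<bullet> (x - a)) - \<kappa>/4 * (norm (a - x))\<^sup>2 + 1/(4*\<kappa>) * (norm (grad F a))\<^sup>2)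
    + ((1/2) *\<^sub>R (x - a) - (1/(2*\<kappa>)) *\<^sub>R grad F a) \<bullet> v + 1/(4*\<kappa>) * (norm v)\<^sup>2"
  using assms unfolding Psi_minus_def power2_norm_eq_inner
  by (simp add: inner_simps inner_commute field_simps power2_eq_square)

lemma Psi_minus_convex_combination:
  assumes "\<kappa> > 0"
  shows "Psi_minus \<kappa> F x a ((1-t) *\<^sub>R d + t *\<^sub>R v) =
    (1-t) * Psi_minus \<kappa> F x a d + t * Psi_minus \<kappa> F x a v - t * (1-t) * (1/(4*\<kappa>) * (norm (v - d))\<^sup>2)"
  using assms unfolding Psi_minus_def power2_norm_eq_inner
  by (simp add: inner_simps inner_commute field_simps power2_eq_square)

definition admissible ::
  "real \<Rightarrow> ('a::euclidean_space) field1 \<Rightarrow> 'a set \<Rightarrow> 'a \<Rightarrow> real \<Rightarrow> 'a \<Rightarrow> bool"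
  where "admissible \<kappa> F \<Omega> x s v \<longleftrightarrow> (\<forall>a\<in>\<Omega>. Psi_minus \<kappa> F x a v \<le> s)"

text \<open>The quadratic gap in the minimality condition gives the uniqueness of the least jet, and
  its constant \<open>1/(4*\<kappa>)\<close> is the one needed to compare the least jets at two points.\<close>

definition least_jet ::
  "real \<Rightarrow> ('a::euclidean_space) field1 \<Rightarrow> 'a set \<Rightarrow> 'a \<Rightarrow> real \<Rightarrow> 'a \<Rightarrow> bool"
  where "least_jet \<kappa> F \<Omega> x u d \<longleftrightarrow> admissible \<kappa> F \<Omega> x u d \<and>
    (\<forall>s v. admissible \<kappa> F \<Omega> x s v \<longrightarrow> u + 1/(4*\<kappa>) * (norm (v - d))\<^sup>2 \<le> s)"

text \<open>Compactness gives a minimiser \<open>d\<close> with value \<open>u\<close>. For the gap, compare \<open>d\<close> with the points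
  \<open>(1-t) *\<^sub>R d + t *\<^sub>R v\<close> of the segment towards \<open>v\<close>, where strong convexity gains
  \<open>t * (1-t)\<close> times the gap, divide by \<open>t\<close> and let \<open>t\<close> tend to 0.\<close>

lemma least_jet_exists:
  assumes "\<kappa> > 0" "\<Omega> \<noteq> {}" "admissible \<kappa> F \<Omega> x s0 v0"
  shows "\<exists>u d. least_jet \<kappa> F \<Omega> x u d"
proof -
  define c where "c a = val F a + 1/2 * (grad F a \<bullet> (x - a)) - \<kappa>/4 * (norm (a - x))\<^sup>2
      + 1/(4*\<kappa>) * (norm (grad F a))\<^sup>2" for a
  define q where "q a = (1/2) *\<^sub>R (x - a) - (1/(2*\<kappa>)) *\<^sub>R grad F a" for a
  have Psi: "Psi_minus \<kappa> F x a v = c a + q a \<bullet> v + 1/(4*\<kappa>) * (norm v)\<^sup>2" for a v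
    unfolding c_def q_def by (rule Psi_minus_eq_affine_plus_square[OF assms(1)])
  have "1/(4*\<kappa>) > 0" using assms(1) by simp
  moreover have "\<forall>a\<in>\<Omega>. c a + q a \<bullet> v0 + 1/(4*\<kappa>) * (norm v0)\<^sup>2 \<le> s0"
    using assms(3) unfolding admissible_def Psi .
  ultimately obtain u d where "\<forall>a\<in>\<Omega>. c a + q a \<bullet> d + 1/(4*\<kappa>) * (norm d)\<^sup>2 \<le> u"
    and "\<And>s v. \<forall>a\<in>\<Omega>. c a + q a \<bullet> v + 1/(4*\<kappa>) * (norm v)\<^sup>2 \<le> s \<Longrightarrow> u \<le> s"
    using exists_min_sup_affine_plus_square[OF _ assms(2)] by metis
  note ud = this[folded Psi]
  have "u + 1/(4*\<kappa>) * (norm (v - d))\<^sup>2 \<le> s" if sv: "\<forall>a\<in>\<Omega>. Psi_minus \<kappa> F x a v \<le> s" for s v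
  proof -
    let ?Q = "1/(4*\<kappa>) * (norm (v - d))\<^sup>2"
    have "r * ?Q \<le> s - u" if r: "0 < r" "r < 1" for r
    proof -
      \<comment> \<open>The limit of small \<open>t\<close> is the limit of factors \<open>r\<close> close to 1.\<close>
      define t where "t = 1 - r"
      have t: "0 < t" "t < 1" using r by (auto simp: t_def)
      have "Psi_minus \<kappa> F x a ((1-t) *\<^sub>R d + t *\<^sub>R v) \<le> (1-t) * u + t * s - t * (1-t) * ?Q"
        if "a \<in> \<Omega>" for a
        unfolding Psi_minus_convex_combination[OF assms(1)]
        using ud(1) sv that t by (intro diff_right_mono add_mono mult_left_mono) auto
      then have "u \<le> (1-t) * u + t * s - t * (1-t) * ?Q" using ud(2) by blast
      then have "t * (r * ?Q) \<le> t * (s - u)" by (simp add: t_def algebra_simps)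
      then show ?thesis using t by (simp only: mult_le_cancel_left_pos)
    qed
    then have "?Q \<le> s - u" by (rule field_le_mult_one_interval)
    then show ?thesis by simp
  qed
  then have "least_jet \<kappa> F \<Omega> x u d"
    using ud(1) by (simp add: least_jet_def admissible_def)
  then show ?thesis by blast
qed

lemma least_jet_unique:
  assumes "\<kappa> > 0" "least_jet \<kappa> F \<Omega> x u d" "admissible \<kappa> F \<Omega> x s v" "s \<le> u"
  shows "s = u" and "v = d"
proof -
  have le: "u + 1/(4*\<kappa>) * (norm (v - d))\<^sup>2 \<le> s" using assms(2,3) by (simp add: least_jet_def)
  have nn: "0 \<le> 1/(4*\<kappa>) * (norm (v - d))\<^sup>2" using assms(1) by simp
  from le nn assms(4) show "s = u" by linarith
  from le nn assms(4) have "1/(4*\<kappa>) * (norm (v - d))\<^sup>2 = 0" by linarith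
  then show "v = d" using assms(1) by simp
qed

section \<open>Comparing least jets at different points\<close>

text \<open>The point \<open>(1/2) *\<^sub>R x - (1/(2*\<kappa>)) *\<^sub>R v\<close> is the same for \<open>(y, v)\<close> and for
  \<open>(x, v + \<kappa> *\<^sub>R (x - y))\<close>, and apart from a term free of \<open>a\<close>, \<open>Psi_minus \<kappa> F x a v\<close> depends on
  \<open>(x, v)\<close> only through it. So the change below is the same for all \<open>a\<close>.\<close>

lemma Psi_minus_transport:
  assumes "\<kappa> > 0"
  shows "Psi_minus \<kappa> F x a (v + \<kappa> *\<^sub>R (x - y)) =
    Psi_minus \<kappa> F y a v + v \<bullet> (x - y) + \<kappa>/2 * (norm (x - y))\<^sup>2"
  unfolding Psi_minus_def diff_diff_eq[symmetric] inverse_scaled_square_minus[OF assms]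
  unfolding power2_norm_eq_inner
  by (simp add: inner_simps inner_commute algebra_simps)

lemma admissible_transport:
  assumes "\<kappa> > 0" "admissible \<kappa> F \<Omega> y s v"
  shows "admissible \<kappa> F \<Omega> x (s + v \<bullet> (x - y) + \<kappa>/2 * (norm (x - y))\<^sup>2) (v + \<kappa> *\<^sub>R (x - y))"
  using assms by (auto simp: admissible_def Psi_minus_transport)

text \<open>The least jet at \<open>y\<close>, moved to \<open>x\<close>, is admissible there; its distance from the least jet
  at \<open>x\<close> costs a quadratic gap, and the resulting inequality is a rewriting of the claim.\<close>

lemma Psi_minus_le_least_jets:
  assumes "\<kappa> > 0" "least_jet \<kappa> F \<Omega> x (val U x) (grad U x)" "least_jet \<kappa> F \<Omega> y (val U y) (grad U y)"
  shows "Psi_minus \<kappa> U y x (grad U y) \<le> val U y"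
proof -
  let ?u = "val U" and ?d = "grad U"
  have "admissible \<kappa> F \<Omega> y (?u y) (?d y)"
    using assms(3) by (simp add: least_jet_def)
  from admissible_transport[OF assms(1) this]
  have le: "?u x + 1/(4*\<kappa>) * (norm (?d x - (?d y + \<kappa> *\<^sub>R (x - y))))\<^sup>2
      \<le> ?u y + ?d y \<bullet> (x - y) + \<kappa>/2 * (norm (x - y))\<^sup>2"
    using assms(2) unfolding least_jet_def norm_minus_commute[of "?d x"] by blast
  have "?u y - Psi_minus \<kappa> U y x (?d y) = ?u y + ?d y \<bullet> (x - y) + \<kappa>/2 * (norm (x - y))\<^sup>2
      - (?u x + 1/(4*\<kappa>) * (norm (?d x - (?d y + \<kappa> *\<^sub>R (x - y))))\<^sup>2)"
    unfolding Psi_minus_def diff_diff_eq[symmetric] inverse_scaled_square_minus[OF assms(1)]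
    unfolding power2_norm_eq_inner
    by (simp add: inner_simps inner_commute algebra_simps)
  with le show ?thesis by linarith
qed

text \<open>At a point of \<open>\<Omega>\<close> the bound coming from that point itself is a paraboloid with vertex
  at the jet of \<open>F\<close>, and this jet satisfies the other bounds too.\<close>

lemma least_jet_on_domain:
  assumes "\<kappa> > 0" "\<forall>a\<in>\<Omega>. \<forall>b\<in>\<Omega>. Psi_minus \<kappa> F b a (grad F b) \<le> val F b" "x \<in> \<Omega>"
  shows "least_jet \<kappa> F \<Omega> x (val F x) (grad F x)"
proof -
  have "val F x + 1/(4*\<kappa>) * (norm (v - grad F x))\<^sup>2 \<le> s" if "admissible \<kappa> F \<Omega> x s v" for s v
    using that assms(3) Psi_minus_self[of \<kappa> F x v]
    by (auto simp: admissible_def norm_minus_commute)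
  then show ?thesis
    using assms by (auto simp: least_jet_def admissible_def)
qed

section \<open>The gradient of an MLE lies in the set of candidates\<close>

lemma two_kappa_mult_Psi_minus:
  assumes "\<kappa> > 0"
  shows "2 * \<kappa> * Psi_minus \<kappa> F x a v = 2 * \<kappa> * val F a + \<kappa> * ((grad F a + v) \<bullet> (x - a))
    - \<kappa>\<^sup>2 / 2 * (norm (a - x))\<^sup>2 + 1/2 * (norm (grad F a - v))\<^sup>2"
  using assms by (simp add: Psi_minus_def field_simps power2_eq_square)

text \<open>The ball with centre \<open>center \<kappa> F a b\<close> consists of the gradients for which the upper bound
  that \<open>a\<close> puts on the value at \<open>x\<close> is at least the lower bound that \<open>b\<close> puts on it. The upper
  bound appears here as the lower bound, at \<open>a\<close>, coming from the jet at \<open>x\<close>.\<close>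

lemma norm_center_le_radiusI:
  assumes "\<kappa> > 0" "Psi_minus \<kappa> F x b (grad G x) \<le> val G x" "Psi_minus \<kappa> G a x (grad G a) \<le> val G a"
    and "G a = F a"
  shows "norm (grad G x - center \<kappa> F a b) \<le> radius \<kappa> F a b x"
proof -
  have "alpha \<kappa> F a b + beta \<kappa> F a b x - (norm (grad G x - center \<kappa> F a b))\<^sup>2 =
    2 * \<kappa> * ((val G a - Psi_minus \<kappa> G a x (grad G a)) + (val G x - Psi_minus \<kappa> F x b (grad G x)))"
    unfolding distrib_left right_diff_distrib two_kappa_mult_Psi_minus[OF assms(1)] assms(4)
      alpha_def beta_def center_def power2_norm_eq_inner
    by (simp add: inner_simps inner_commute algebra_simps power2_eq_square)
      (simp add: field_simps)
  moreover have "0 \<le> 2 * \<kappa> * ((val G a - Psi_minus \<kappa> G a x (grad G a)) + (val G x - Psi_minus \<kappa> F x b (grad G x)))"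
    using assms by (intro mult_nonneg_nonneg add_nonneg_nonneg) auto
  ultimately show ?thesis
    unfolding radius_def by (intro real_le_rsqrt) linarith
qed

section \<open>Least jets as the field \<open>U_minus\<close>\<close>

lemma sup_Psi_minus_le_iff:
  "sup_Psi_minus \<kappa> F \<Omega> x v \<le> ereal s \<longleftrightarrow> admissible \<kappa> F \<Omega> x s v"
  by (simp add: sup_Psi_minus_def admissible_def SUP_le_iff)

lemma least_jet_sup_Psi_minus:
  assumes "\<kappa> > 0" "least_jet \<kappa> F \<Omega> x u d"
  shows "sup_Psi_minus \<kappa> F \<Omega> x d = ereal u"
    and "ereal u \<le> sup_Psi_minus \<kappa> F \<Omega> x v"
    and "sup_Psi_minus \<kappa> F \<Omega> x v \<le> ereal u \<Longrightarrow> v = d"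
proof -
  have lower: "ereal u \<le> sup_Psi_minus \<kappa> F \<Omega> x v" for v
  proof (cases "sup_Psi_minus \<kappa> F \<Omega> x v")
    case (real s)
    then have "admissible \<kappa> F \<Omega> x s v" by (simp flip: sup_Psi_minus_le_iff)
    with least_jet_unique(1)[OF assms] show ?thesis
      using real by (cases "s \<le> u") auto
  next
    case MInf
    then have "admissible \<kappa> F \<Omega> x (u - 1) v" by (simp flip: sup_Psi_minus_le_iff)
    with least_jet_unique(1)[OF assms] show ?thesis by fastforce
  qed simp
  show "ereal u \<le> sup_Psi_minus \<kappa> F \<Omega> x v" by (rule lower)
  have "admissible \<kappa> F \<Omega> x u d" using assms(2) by (simp add: least_jet_def)
  then have "sup_Psi_minus \<kappa> F \<Omega> x d \<le> ereal u" by (simp add: sup_Psi_minus_le_iff)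
  with lower show "sup_Psi_minus \<kappa> F \<Omega> x d = ereal u" by (rule antisym[rotated])
  show "v = d" if "sup_Psi_minus \<kappa> F \<Omega> x v \<le> ereal u"
    using that least_jet_unique(2)[OF assms] by (simp add: sup_Psi_minus_le_iff)
qed

text \<open>The least jet minimises the supremum over all gradients. Once its gradient belongs to
  \<open>\<Lambda>\<^sub>x\<close>, it is also the minimiser over \<open>\<Lambda>\<^sub>x\<close>, and the only one, so \<^const>\<open>arg_min_on\<close> must
  choose it.\<close>

lemma U_minus_eqI:
  assumes "Gamma1 F \<Omega> = ennreal \<kappa>" "\<kappa> > 0" "least_jet \<kappa> F \<Omega> x u d"
    and "d \<in> Lambda_set \<kappa> F \<Omega> x"
  shows "U_minus F \<Omega> x = (u, d)"
proof -
  note sup = least_jet_sup_Psi_minus[OF assms(2,3)]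
  let ?\<Lambda> = "Lambda_set \<kappa> F \<Omega> x" and ?\<Psi> = "sup_Psi_minus \<kappa> F \<Omega> x"
  note d = assms(4)
  have "(INF v\<in>?\<Lambda>. ?\<Psi> v) = ereal u"
    by (rule antisym) (auto intro!: INF_lower2[OF d] INF_greatest simp: sup(1,2))
  moreover have "is_arg_min ?\<Psi> (\<lambda>v. v \<in> ?\<Lambda>) v \<longleftrightarrow> v = d" for v
    using sup d by (auto simp: is_arg_min_linorder)
  then have "arg_min_on ?\<Psi> ?\<Lambda> = d"
    by (simp add: arg_min_on_def arg_min_def)
  ultimately show ?thesis
    using assms(1,2) by (simp add: U_minus_def)
qed

section \<open>Minimal Lipschitz extensions\<close>

lemma poly1_eq_iff: "poly1 G x = poly1 F x \<longleftrightarrow> G x = F x"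
proof
  assume eq: "poly1 G x = poly1 F x"
  from fun_cong[OF eq, of x] have "val G x = val F x" by (simp add: poly1_def)
  moreover have "grad G x \<bullet> w = grad F x \<bullet> w" for w
    using fun_cong[OF eq, of "x + w"] calculation by (simp add: poly1_def)
  then have "grad G x = grad F x" using vector_eq_rdot by blast
  ultimately show "G x = F x" by (simp add: prod_eq_iff)
qed (auto simp: poly1_def)

lemma Gamma1_mono_extension:
  assumes "\<forall>x\<in>\<Omega>. G x = F x" "\<Omega> \<subseteq> \<Omega>'"
  shows "Gamma1 F \<Omega> \<le> Gamma1 G \<Omega>'"
proof -
  have "Gamma1 F \<Omega> = Gamma1 G \<Omega>"
    unfolding Gamma1_def
    by (intro SUP_cong) (use assms(1) in \<open>auto simp: Gamma1_pair_def poly1_def\<close>)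
  also have "\<dots> \<le> Gamma1 G \<Omega>'"
    unfolding Gamma1_def using assms(2) by (intro SUP_subset_mono) auto
  finally show ?thesis .
qed

lemma is_MLE_iff:
  assumes "Gamma1 F \<Omega> = ennreal \<kappa>" "\<kappa> > 0" "\<Omega> \<subseteq> \<Omega>'"
  shows "is_MLE F \<Omega> \<Omega>' G \<longleftrightarrow> (\<forall>x\<in>\<Omega>. G x = F x) \<and>
    (\<forall>x\<in>\<Omega>'. \<forall>y\<in>\<Omega>'. Psi_minus \<kappa> G y x (grad G y) \<le> val G y)"
proof -
  have "is_MLE F \<Omega> \<Omega>' G \<longleftrightarrow> (\<forall>x\<in>\<Omega>. G x = F x) \<and> Gamma1 G \<Omega>' = ennreal \<kappa>"
    by (auto simp: is_MLE_def is_extension_def fields1_def poly1_eq_iff assms(1))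
  also have "\<dots> \<longleftrightarrow> (\<forall>x\<in>\<Omega>. G x = F x) \<and> Gamma1 G \<Omega>' \<le> ennreal \<kappa>"
    using Gamma1_mono_extension[of \<Omega> G F \<Omega>'] assms(1,3) by auto
  finally show ?thesis by (simp add: Gamma1_le_iff[OF assms(2)])
qed

text \<open>The bridge from MLEs to least jets: of all the inequalities that \<open>K\<close> satisfies, only those
  between \<open>x\<close> and points of \<open>\<Omega>\<close>, where \<open>K\<close> is known, are kept.\<close>

lemma MLE_admissible:
  assumes "Gamma1 F \<Omega> = ennreal \<kappa>" "\<kappa> > 0" "is_MLE F \<Omega> UNIV K"
  shows "admissible \<kappa> F \<Omega> x (val K x) (grad K x)"
proof -
  have K: "\<forall>x\<in>\<Omega>. K x = F x" "\<forall>x y. Psi_minus \<kappa> K y x (grad K y) \<le> val K y"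
    using assms(3) by (simp_all add: is_MLE_iff[OF assms(1,2)])
  have "Psi_minus \<kappa> F x a (grad K x) \<le> val K x" if "a \<in> \<Omega>" for a
    using K(2)[rule_format, of x a] K(1) that by (simp add: Psi_minus_def)
  then show ?thesis by (auto simp: admissible_def)
qed

text \<open>The least jets are chosen at each point separately and form a field \<open>U\<close>; the
  comparison of least jets makes \<open>U\<close> an MLE, which in turn puts its gradients into the sets
  \<open>\<Lambda>\<^sub>x\<close>, and only then is \<open>U\<close> known to be \<open>U_minus F \<Omega>\<close>.\<close>

lemma least_jet_U_minus:
  assumes "Gamma1 F \<Omega> = ennreal \<kappa>" "\<kappa> > 0" "\<Omega> \<noteq> {}"
  shows "least_jet \<kappa> F \<Omega> x (val (U_minus F \<Omega>) x) (grad (U_minus F \<Omega>) x)"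
    and "is_MLE F \<Omega> UNIV (U_minus F \<Omega>)"
proof -
  have F: "\<forall>a\<in>\<Omega>. \<forall>b\<in>\<Omega>. Psi_minus \<kappa> F b a (grad F b) \<le> val F b"
    using Gamma1_le_iff[OF assms(2), of F \<Omega>] assms(1) by simp
  obtain a where "a \<in> \<Omega>" using assms(3) by auto
  then have a: "admissible \<kappa> F \<Omega> a (val F a) (grad F a)"
    using F by (simp add: admissible_def)
  have "\<exists>u d. least_jet \<kappa> F \<Omega> x u d" for x
    by (rule least_jet_exists[OF assms(2,3) admissible_transport[OF assms(2) a]])
  then obtain u d where "\<And>x. least_jet \<kappa> F \<Omega> x (u x) (d x)" by metis
  then obtain U :: "'a field1" where U: "\<And>x. least_jet \<kappa> F \<Omega> x (val U x) (grad U x)"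
    using that[of "\<lambda>x. (u x, d x)"] by simp
  have ext: "U x = F x" if "x \<in> \<Omega>" for x
  proof -
    have least: "least_jet \<kappa> F \<Omega> x (val F x) (grad F x)"
      by (rule least_jet_on_domain[OF assms(2) F that])
    have adm: "admissible \<kappa> F \<Omega> x (val F x) (grad F x)" "admissible \<kappa> F \<Omega> x (val U x) (grad U x)"
      using least U[of x] by (simp_all add: least_jet_def)
    show ?thesis
      using least_jet_unique[OF assms(2) least adm(2)] least_jet_unique[OF assms(2) U adm(1)]
      by (metis linear prod_eq_iff)
  qed
  have pair: "Psi_minus \<kappa> U y x (grad U y) \<le> val U y" for x y
    by (rule Psi_minus_le_least_jets[where \<Omega> = \<Omega>, OF assms(2) U U])
  have "U_minus F \<Omega> x = (val U x, grad U x)" for x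
  proof (rule U_minus_eqI[OF assms(1,2) U])
    have "norm (grad U x - center \<kappa> F a b) \<le> radius \<kappa> F a b x" if "a \<in> \<Omega>" "b \<in> \<Omega>" for a b
      using that ext pair[of a x] U[of x]
      by (intro norm_center_le_radiusI[OF assms(2)]) (auto simp: least_jet_def admissible_def)
    then show "grad U x \<in> Lambda_set \<kappa> F \<Omega> x" by (simp add: Lambda_set_def)
  qed
  then have "U_minus F \<Omega> = U" by auto
  then show "least_jet \<kappa> F \<Omega> x (val (U_minus F \<Omega>) x) (grad (U_minus F \<Omega>) x)"
    and "is_MLE F \<Omega> UNIV (U_minus F \<Omega>)"
    using U ext pair by (simp_all add: is_MLE_iff[OF assms(1,2)])
qed

theorem theorem24:
  fixes F :: "(real ^ 'n) field1" and \<Omega> :: "(real ^ 'n) set"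
  assumes "\<Omega> \<noteq> {}"
    and "F \<in> fields1 \<Omega>"
    and "Gamma1 F \<Omega> > 0"
  shows "is_under_extremal F \<Omega> UNIV (U_minus F \<Omega>) \<and>
    (\<forall>G. is_under_extremal F \<Omega> UNIV G \<longrightarrow> G = U_minus F \<Omega>)"
proof -
  obtain \<kappa> where \<kappa>: "Gamma1 F \<Omega> = ennreal \<kappa>" "\<kappa> > 0"
    using assms(2,3) by (cases "Gamma1 F \<Omega>") (auto simp: fields1_def)
  let ?U = "U_minus F \<Omega>"
  note least = least_jet_U_minus(1)[OF \<kappa> assms(1)]
  have extremal: "is_under_extremal F \<Omega> UNIV ?U"
  proof -
    have "val ?U x \<le> val K x" if "is_MLE F \<Omega> UNIV K" for K x
      using least_jet_unique(1)[OF \<kappa>(2) least MLE_admissible[OF \<kappa> that]] by (metis linear order_refl)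
    then show ?thesis
      using least_jet_U_minus(2)[OF \<kappa> assms(1)] by (simp add: is_under_extremal_def)
  qed
  moreover have "G = ?U" if "is_under_extremal F \<Omega> UNIV G" for G
  proof
    fix x
    have "is_MLE F \<Omega> UNIV G" "val G x \<le> val ?U x"
      using that extremal by (auto simp: is_under_extremal_def)
    then show "G x = ?U x"
      using least_jet_unique[OF \<kappa>(2) least MLE_admissible[OF \<kappa>]] by (metis prod_eq_iff)
  qed
  ultimately show ?thesis by blast
qed

end
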